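(* Let $f:X\to Y$ be a quasi-isometry of proper CAT(0) metric spaces with quasi-inverse $g:Y\to X$, and let $\omega$ be a non-principal ultrafilter on $\mathbb N$. If $\alpha\in\partial X$ is a Morse ray, then $f^d(\alpha)=f^{d'}(\alpha)$ and $g^{d'}\circ f^d(\alpha)=\alpha$ for all scaling sequences $d,d'$.
   Context: $f:X\to Y$ is a $(\lambda,C)$-quasi-isometric embedding if $\frac1\lambda \mathrm{dist}(x,y)-C\le \mathrm{dist}(f(x),f(y))\le\lambda\,\mathrm{dist}(x,y)+C$ for all $x,y\in X$, and a quasi-isometry if moreover $Y$ is the $C$-neighborhood of its image. A quasi-inverse of $f$ is a map $g:Y\to X$ such that $f\circ g$ and $g\circ f$ are at bounded distance from the identity maps; it is itself a quasi-isometry. $\partial X$ is the set of geodesic rays in $X$ issuing from a fixed basepoint $x_0$, and $\partial Y$ is the set of geodesic rays in $Y$ issuing from $f(x_0)$. Rays with different basepoints are identified when they are asymptotic (finite Hausdorff distance), each asymptoty class having exactly one representative from any given basepoint; the equality $g^{d'}\circ f^d(\alpha)=\alpha$ is understood in this sense. A scaling sequence is a sequence $d=(d_n)$ of positive reals with $\lim^\omega d_n=\infty$. For a quasi-isometric embedding $f:X\to Y$ of proper CAT(0) spaces, $f^d:\partial X\to\partial Y$ sends $\alpha$ to the geodesic ray $f^d(\alpha)=\lim^\omega[f\circ\alpha(0),f\circ\alpha(d_n)]$, the pointwise $\omega$-limit of the geodesic segments from $f(\alpha(0))$ to $f(\alpha(d_n))$. A (quasi-)geodesic $\gamma$ is Morse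 if for every $L\ge1$ and $C\ge0$ there is $M=M(L,C)$ such that every $(L,C)$-quasi-geodesic with endpoints on $\gamma$ remains $M$-close to $\gamma$. A Morse ray in $\partial X$ is an element of $\partial X$ that is Morse. *)

theory Defs
  imports "HOL-Analysis.Analysis"
begin

section \<open>Ultrafilters\<close>

definition nonprincipal_ultrafilter :: "'n filter \<Rightarrow> bool" where
  "nonprincipal_ultrafilter F \<longleftrightarrow>
     F \<noteq> bot \<and>
     (\<forall>P. eventually P F \<or> eventually (\<lambda>n. \<not> P n) F) \<and>
     (\<forall>n. F \<noteq> principal {n})"

definition scaling_sequence :: "nat filter \<Rightarrow> (nat \<Rightarrow> real) \<Rightarrow> bool" where
  "scaling_sequence \<omega> d \<longleftrightarrow> (\<forall>n. d n > 0) \<and> filterlim d at_top \<omega>"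


section \<open>CAT(0) spaces\<close>

definition geodesic_between :: "'a::metric_space \<Rightarrow> 'a \<Rightarrow> (real \<Rightarrow> 'a) \<Rightarrow> bool" where
  "geodesic_between x y c \<longleftrightarrow>
     c 0 = x \<and> c (dist x y) = y \<and>
     (\<forall>s\<in>{0..dist x y}. \<forall>t\<in>{0..dist x y}. dist (c s) (c t) = \<bar>s - t\<bar>)"

text \<open>
  In the comparison axiom, \<open>x'\<close>, \<open>y'\<close>, \<open>z'\<close> is a comparison triangle in the Euclidean plane;
  a point \<open>p'\<close> of \<open>[x', y']\<close> is the comparison point of \<open>c (dist x' p')\<close> on the side \<open>c\<close>.
  Any two distinct sides of a triangle share a vertex, here called \<open>x\<close>, and for two points on
  the same side the comparison inequality is an equality, so all pairs of points on a geodesic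
  triangle are covered.
\<close>

class cat0_space = metric_space +
  assumes geodesic_between_exists: "\<exists>c. geodesic_between x y c"
    and cat0_comparison:
      "\<lbrakk>geodesic_between x y c; geodesic_between x z e;
        dist x' y' = dist x y; dist x' z' = dist x z; dist y' z' = dist y z;
        p' \<in> closed_segment x' y'; q' \<in> closed_segment x' z'\<rbrakk>
       \<Longrightarrow> dist (c (dist x' p')) (e (dist x' q')) \<le> dist p' (q' :: real^2)"

text \<open>
  Properness is the library class \<open>heine_borel\<close>: every bounded sequence has a convergent
  subsequence.
\<close>


section \<open>Quasi-isometries\<close>

definition quasi_isometric_embedding_on ::
    "'a::metric_space set \<Rightarrow> real \<Rightarrow> real \<Rightarrow> ('a \<Rightarrow> 'b::metric_space) \<Rightarrow> bool" where
  "quasi_isometric_embedding_on S L C f \<longleftrightarrow>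
     L \<ge> 1 \<and> C \<ge> 0 \<and>
     (\<forall>x\<in>S. \<forall>y\<in>S. 1 / L * dist x y - C \<le> dist (f x) (f y) \<and>
                     dist (f x) (f y) \<le> L * dist x y + C)"

definition quasi_isometry :: "('a::metric_space \<Rightarrow> 'b::metric_space) \<Rightarrow> bool" where
  "quasi_isometry f \<longleftrightarrow>
     (\<exists>L C. quasi_isometric_embedding_on UNIV L C f \<and> (\<forall>y. \<exists>x. dist y (f x) \<le> C))"

definition quasi_inverse ::
    "('a::metric_space \<Rightarrow> 'b::metric_space) \<Rightarrow> ('b \<Rightarrow> 'a) \<Rightarrow> bool" where
  "quasi_inverse f g \<longleftrightarrow>
     (\<exists>K. (\<forall>x. dist ((g \<circ> f) x) x \<le> K) \<and> (\<forall>y. dist ((f \<circ> g) y) y \<le> K))"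


section \<open>Geodesic rays and the Morse property\<close>

text \<open>
  A ray is a function on \<open>[0, \<infinity>)\<close>; it is taken to be \<open>extensional\<close> so that equality of rays is
  equality of HOL functions.
\<close>

definition boundary :: "'a::metric_space \<Rightarrow> (real \<Rightarrow> 'a) set" where
  "boundary x0 =
     {c \<in> extensional {0..}. c 0 = x0 \<and> (\<forall>s\<ge>0. \<forall>t\<ge>0. dist (c s) (c t) = \<bar>s - t\<bar>)}"

text \<open>Finite Hausdorff distance between the images of two rays.\<close>

definition asymptotic :: "(real \<Rightarrow> 'a::metric_space) \<Rightarrow> (real \<Rightarrow> 'a) \<Rightarrow> bool" where
  "asymptotic c e \<longleftrightarrow>
     (\<exists>K. (\<forall>s\<ge>0. \<exists>t\<ge>0. dist (c s) (e t) \<le> K) \<and> (\<forall>t\<ge>0. \<exists>s\<ge>0. dist (c s) (e t) \<le> K))"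

text \<open>The path \<open>\<gamma>\<close> has domain \<open>I\<close>; quasi-geodesics are not required to be continuous.\<close>

definition morse_on :: "real set \<Rightarrow> (real \<Rightarrow> 'a::metric_space) \<Rightarrow> bool" where
  "morse_on I \<gamma> \<longleftrightarrow>
     (\<forall>L\<ge>1. \<forall>C\<ge>0. \<exists>M. \<forall>(a::real) b q.
        a \<le> b \<and> quasi_isometric_embedding_on {a..b} L C q \<and> q a \<in> \<gamma> ` I \<and> q b \<in> \<gamma> ` I \<longrightarrow>
        (\<forall>t\<in>{a..b}. \<exists>s\<in>I. dist (q t) (\<gamma> s) \<le> M))"


section \<open>The map induced on boundaries\<close>

text \<open>
  In a CAT(0) space the geodesic from \<open>x\<close> to \<open>y\<close> is unique, so the choice only affects values
  outside \<open>[0, dist x y]\<close>.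
\<close>

definition geodesic_segment :: "'a::metric_space \<Rightarrow> 'a \<Rightarrow> real \<Rightarrow> 'a" where
  "geodesic_segment x y = (SOME c. geodesic_between x y c)"

text \<open>
  For a quasi-isometric embedding \<open>f\<close>, the length of the \<open>n\<close>-th segment tends to infinity
  along \<open>\<omega>\<close>, so for each \<open>t \<ge> 0\<close> the segments are defined at \<open>t\<close> for \<open>\<omega>\<close>-almost every \<open>n\<close>; the
  limit exists when the target is proper.
\<close>

definition boundary_map ::
    "nat filter \<Rightarrow> ('a::metric_space \<Rightarrow> 'b::metric_space) \<Rightarrow> (nat \<Rightarrow> real)
      \<Rightarrow> (real \<Rightarrow> 'a) \<Rightarrow> (real \<Rightarrow> 'b)" where
  "boundary_map \<omega> f d \<alpha> =
     (\<lambda>t\<in>{0..}. Lim \<omega> (\<lambda>n. geodesic_segment ((f \<circ> \<alpha>) 0) ((f \<circ> \<alpha>) (d n)) t))"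

end

theory Submission
  imports Defs
begin

text \<open>
  The image under \<open>g\<close> of the segment \<open>[f (\<alpha> 0), f (\<alpha> (d n))]\<close> is a quasi-geodesic whose endpoints
  are close to \<open>\<alpha>\<close>, so by the Morse property it stays close to \<open>\<alpha>\<close>, uniformly in \<open>n\<close>. Hence
  \<open>\<beta> = f\<^sup>d(\<alpha>)\<close> is a ray such that \<open>g \<circ> \<beta>\<close> is close to \<open>\<alpha>\<close> and \<open>\<beta>\<close> is close to \<open>f \<circ> \<alpha>\<close>. Two rays
  from the same point that are close to the same quasi-geodesic ray are at bounded distance, and
  so they coincide by CAT(0) comparison; this shows that \<open>\<beta>\<close> does not depend on \<open>d\<close>. Finally the
  segments \<open>[g (\<beta> 0), g (\<beta> (d' n))]\<close> again have endpoints close to \<open>\<alpha>\<close>, and a second application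
  of the Morse property shows that their limit is asymptotic to \<open>\<alpha>\<close>.
\<close>

section \<open>Limits along ultrafilters\<close>

text \<open>Compactness gives a cluster point of the image filter, and the dichotomy of an
  ultrafilter turns a cluster point into a limit: if the preimage of a neighbourhood were not large,
  its complement would be.\<close>

lemma ultrafilter_tendsto_compact:
  fixes h :: "'n \<Rightarrow> 'a::topological_space"
  assumes "nonprincipal_ultrafilter \<omega>" and "compact S" and "eventually (\<lambda>n. h n \<in> S) \<omega>"
  shows "\<exists>l. (h \<longlongrightarrow> l) \<omega>"
proof -
  have "\<omega> \<noteq> bot" and ultra: "\<And>P. eventually P \<omega> \<or> eventually (\<lambda>n. \<not> P n) \<omega>"
    using assms(1) by (auto simp: nonprincipal_ultrafilter_def)
  then have "filtermap h \<omega> \<noteq> bot" by (simp add: filtermap_bot_iff)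
  moreover have "eventually (\<lambda>x. x \<in> S) (filtermap h \<omega>)"
    using assms(3) by (simp add: eventually_filtermap)
  ultimately obtain l where l: "inf (nhds l) (filtermap h \<omega>) \<noteq> bot"
    using assms(2) unfolding compact_filter by blast
  have "eventually (\<lambda>n. h n \<in> U) \<omega>" if "open U" "l \<in> U" for U
  proof (rule ccontr)
    assume "\<not> eventually (\<lambda>n. h n \<in> U) \<omega>"
    then have "eventually (\<lambda>x. x \<notin> U) (filtermap h \<omega>)"
      using ultra[of "\<lambda>n. h n \<in> U"] by (simp add: eventually_filtermap)
    moreover have "eventually (\<lambda>x. x \<in> U) (nhds l)"
      using that by (rule eventually_nhds_in_open)
    ultimately have "eventually (\<lambda>x. False) (inf (nhds l) (filtermap h \<omega>))"
      unfolding eventually_inf by blast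
    then show False using l by (simp add: trivial_limit_def)
  qed
  then show ?thesis by (auto intro: topological_tendstoI)
qed

section \<open>The limit ray\<close>

lemma geodesic_between_geodesic_segment:
  "geodesic_between x y (geodesic_segment x (y::'a::cat0_space))"
  unfolding geodesic_segment_def using geodesic_between_exists by (rule someI_ex)

lemma geodesic_segment_0 [simp]: "geodesic_segment x (y::'a::cat0_space) 0 = x"
  and geodesic_segment_end [simp]: "geodesic_segment x y (dist x y) = y"
  using geodesic_between_geodesic_segment[of x y] by (auto simp: geodesic_between_def)

lemma dist_geodesic_segment:
  fixes x y :: "'a::cat0_space"
  assumes "0 \<le> s" "s \<le> dist x y" "0 \<le> t" "t \<le> dist x y"
  shows "dist (geodesic_segment x y s) (geodesic_segment x y t) = \<bar>s - t\<bar>"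
  using geodesic_between_geodesic_segment[of x y] assms by (auto simp: geodesic_between_def)

lemma boundary_start: "c \<in> boundary x \<Longrightarrow> c 0 = x"
  by (simp add: boundary_def)

lemma boundary_dist: "c \<in> boundary x \<Longrightarrow> 0 \<le> s \<Longrightarrow> 0 \<le> t \<Longrightarrow> dist (c s) (c t) = \<bar>s - t\<bar>"
  by (simp add: boundary_def)

text \<open>\<open>Lim\<close> is a mere choice until convergence is known. Once the segment is
  longer than \<open>t\<close>, its point at time \<open>t\<close> lies in the closed ball of radius
  \<open>t\<close>, which is compact by properness.\<close>

lemma boundary_map_tendsto:
  fixes f :: "'a::metric_space \<Rightarrow> 'b::{cat0_space, heine_borel}"
  assumes "nonprincipal_ultrafilter \<omega>"
    and "filterlim (\<lambda>n. dist (f (\<alpha> 0)) (f (\<alpha> (d n)))) at_top \<omega>"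
    and "0 \<le> t"
  shows "((\<lambda>n. geodesic_segment (f (\<alpha> 0)) (f (\<alpha> (d n))) t) \<longlongrightarrow> boundary_map \<omega> f d \<alpha> t) \<omega>"
proof -
  have "eventually (\<lambda>n. t \<le> dist (f (\<alpha> 0)) (f (\<alpha> (d n)))) \<omega>"
    using assms(2) by (simp add: filterlim_at_top)
  then have seg: "eventually (\<lambda>n. geodesic_segment (f (\<alpha> 0)) (f (\<alpha> (d n))) t \<in> cball (f (\<alpha> 0)) t) \<omega>"
  proof eventually_elim
    case (elim n)
    then show ?case
      using dist_geodesic_segment[of 0 "f (\<alpha> 0)" "f (\<alpha> (d n))" t] \<open>0 \<le> t\<close> by simp
  qed
  have "compact (cball (f (\<alpha> 0)) t)"
    by (simp add: compact_eq_bounded_closed)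
  from ultrafilter_tendsto_compact[OF assms(1) this seg] obtain l where
    l: "((\<lambda>n. geodesic_segment (f (\<alpha> 0)) (f (\<alpha> (d n))) t) \<longlongrightarrow> l) \<omega>"
    by blast
  have "\<omega> \<noteq> bot" using assms(1) by (simp add: nonprincipal_ultrafilter_def)
  then show ?thesis
    using l tendsto_Lim[OF _ l] \<open>0 \<le> t\<close> by (simp add: boundary_map_def)
qed

text \<open>For fixed \<open>s\<close> and \<open>t\<close>, almost every segment is defined at both
  times and isometric there, so the distance passes to the limit.\<close>

lemma boundary_map_in_boundary:
  fixes f :: "'a::metric_space \<Rightarrow> 'b::{cat0_space, heine_borel}"
  assumes \<omega>: "nonprincipal_ultrafilter \<omega>"
    and lim: "filterlim (\<lambda>n. dist (f (\<alpha> 0)) (f (\<alpha> (d n)))) at_top \<omega>"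
  shows "boundary_map \<omega> f d \<alpha> \<in> boundary (f (\<alpha> 0))"
proof -
  let ?c = "\<lambda>n. geodesic_segment (f (\<alpha> 0)) (f (\<alpha> (d n)))" and ?\<beta> = "boundary_map \<omega> f d \<alpha>"
  have nb: "\<omega> \<noteq> bot" using \<omega> by (simp add: nonprincipal_ultrafilter_def)
  have "?\<beta> 0 = f (\<alpha> 0)"
    using boundary_map_tendsto[where f = f and \<alpha> = \<alpha> and d = d, OF assms order.refl] nb by (simp add: tendsto_const_iff)
  moreover have "dist (?\<beta> s) (?\<beta> t) = \<bar>s - t\<bar>" if "0 \<le> s" "0 \<le> t" for s t
  proof -
    have "((\<lambda>n. dist (?c n s) (?c n t)) \<longlongrightarrow> dist (?\<beta> s) (?\<beta> t)) \<omega>"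
      by (intro tendsto_dist boundary_map_tendsto assms that)
    moreover have "eventually (\<lambda>n. max s t \<le> dist (f (\<alpha> 0)) (f (\<alpha> (d n)))) \<omega>"
      using lim unfolding filterlim_at_top by blast
    then have "eventually (\<lambda>n. dist (?c n s) (?c n t) = \<bar>s - t\<bar>) \<omega>"
      by eventually_elim (use that in \<open>simp add: dist_geodesic_segment\<close>)
    then have "((\<lambda>n. dist (?c n s) (?c n t)) \<longlongrightarrow> \<bar>s - t\<bar>) \<omega>"
      by (rule tendsto_eventually)
    ultimately show ?thesis using nb tendsto_unique by blast
  qed
  ultimately show ?thesis
    by (simp add: boundary_def boundary_map_def)
qed

section \<open>Rays at bounded distance from each other\<close>

lemma geodesic_between_boundary:
  assumes "c \<in> boundary x" "0 \<le> T"
  shows "geodesic_between x (c T) c" and "dist x (c T) = T"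
proof -
  show *: "dist x (c T) = T"
    using assms boundary_dist[OF assms(1), of 0 T] boundary_start[OF assms(1)] by simp
  show "geodesic_between x (c T) c"
    unfolding geodesic_between_def * using assms boundary_start[OF assms(1)]
    by (auto intro: boundary_dist)
qed

text \<open>Supplies the comparison triangle for two rays from one point, with apex at the origin
  and base symmetric about the second axis; \<open>D \<le> 2 * T\<close> makes the height
  \<open>h\<close> real.\<close>

lemma isosceles_triangle_exists:
  fixes T D :: real
  assumes "0 \<le> T" "0 \<le> D" "D \<le> 2 * T"
  obtains y z :: "real^2" where "norm y = T" "norm z = T" "dist y z = D"
proof
  define h where "h = sqrt (T\<^sup>2 - (D / 2)\<^sup>2)"
  have "(D / 2)\<^sup>2 \<le> T\<^sup>2" using assms by (intro power_mono) auto
  then have h: "h\<^sup>2 = T\<^sup>2 - (D / 2)\<^sup>2" by (simp add: h_def)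
  let ?y = "vector [D / 2, h] :: real^2" and ?z = "vector [- (D / 2), h] :: real^2"
  show "norm ?y = T" "norm ?z = T"
    using h assms by (simp_all add: norm_vec_def L2_set_def sum_2)
  show "dist ?y ?z = D"
    using assms by (simp add: dist_vec_def L2_set_def sum_2 dist_real_def)
qed

text \<open>The comparison points at time \<open>t\<close> arise from those at time \<open>T\<close>
  by the homothety of ratio \<open>t / T\<close> centred at the apex, so their distance scales by
  the same ratio.\<close>

lemma cat0_ray_comparison:
  fixes c e :: "real \<Rightarrow> 'a::cat0_space"
  assumes c: "c \<in> boundary x" and e: "e \<in> boundary x" and "0 \<le> t" "t \<le> T" "0 < T"
  shows "dist (c t) (e t) \<le> t / T * dist (c T) (e T)"
proof -
  have cT: "dist x (c T) = T" "geodesic_between x (c T) c"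
    and eT: "dist x (e T) = T" "geodesic_between x (e T) e"
    using geodesic_between_boundary[OF c] geodesic_between_boundary[OF e] \<open>0 < T\<close> by auto
  have "dist (c T) (e T) \<le> 2 * T"
    using dist_triangle3[of "c T" "e T" x] cT(1) eT(1) by simp
  then obtain y z :: "real^2" where yz: "norm y = T" "norm z = T" "dist y z = dist (c T) (e T)"
    using isosceles_triangle_exists[of T "dist (c T) (e T)"] \<open>0 < T\<close> by auto
  let ?p = "(t / T) *\<^sub>R y" and ?q = "(t / T) *\<^sub>R z"
  have "?p \<in> closed_segment 0 y" "?q \<in> closed_segment 0 z"
    using assms by (auto simp: in_segment intro!: exI[of _ "t / T"])
  then have "dist (c (dist 0 ?p)) (e (dist 0 ?q)) \<le> dist ?p ?q"
    using yz cT eT by (intro cat0_comparison[of x "c T" c "e T" e 0 y z]) auto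
  also have "dist ?p ?q = t / T * dist (c T) (e T)"
    using assms yz by (simp add: dist_norm flip: scaleR_diff_right)
  finally show ?thesis using yz assms by simp
qed

text \<open>Comparison bounds the distance at time \<open>t\<close> by \<open>t * R / T\<close> for
  all large \<open>T\<close>; let \<open>T\<close> tend to infinity.\<close>

lemma rays_at_bounded_distance_eq:
  fixes c e :: "real \<Rightarrow> 'a::cat0_space"
  assumes c: "c \<in> boundary x" and e: "e \<in> boundary x" and R: "\<And>t. 0 \<le> t \<Longrightarrow> dist (c t) (e t) \<le> R"
  shows "c = e"
proof
  fix t
  show "c t = e t"
  proof (cases "0 \<le> t")
    case False
    \<comment> \<open>At negative times both rays are \<open>undefined\<close> by
      extensionality.\<close>
    then show ?thesis using c e by (auto simp: boundary_def extensional_def)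
  next
    case True
    have "\<forall>\<^sub>F T in at_top. dist (c t) (e t) \<le> t * R / T"
      using eventually_ge_at_top[of t] eventually_gt_at_top[of 0]
    proof eventually_elim
      case (elim T)
      have "dist (c t) (e t) \<le> t / T * dist (c T) (e T)"
        using cat0_ray_comparison[OF c e True] elim by simp
      also have "\<dots> \<le> t / T * R"
        using R[of T] True elim by (intro mult_left_mono) auto
      finally show ?case by simp
    qed
    moreover have "((\<lambda>T. t * R / T) \<longlongrightarrow> 0) at_top"
      by (intro tendsto_divide_0[OF tendsto_const] filterlim_at_top_imp_at_infinity filterlim_ident)
    ultimately have "dist (c t) (e t) \<le> 0"
      by (intro tendsto_lowerbound) auto
    then show ?thesis by simp
  qed
qed

section \<open>Quasi-isometric embeddings, and rays near a common quasi-geodesic\<close>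

lemma quasi_isometric_embedding_on_bounds:
  assumes "quasi_isometric_embedding_on S L C f" "x \<in> S" "y \<in> S"
  shows "dist (f x) (f y) \<le> L * dist x y + C" and "dist x y \<le> L * (dist (f x) (f y) + C)"
proof -
  have "1 \<le> L" "1 / L * dist x y - C \<le> dist (f x) (f y)"
    using assms by (auto simp: quasi_isometric_embedding_on_def)
  then show "dist x y \<le> L * (dist (f x) (f y) + C)"
    by (simp add: field_simps)
  show "dist (f x) (f y) \<le> L * dist x y + C"
    using assms by (auto simp: quasi_isometric_embedding_on_def)
qed

lemma quasi_isometric_embedding_onI:
  assumes "1 \<le> L" "0 \<le> C"
    and "\<And>x y. x \<in> S \<Longrightarrow> y \<in> S \<Longrightarrow> dist (f x) (f y) \<le> L * dist x y + C"
    and "\<And>x y. x \<in> S \<Longrightarrow> y \<in> S \<Longrightarrow> dist x y \<le> L * (dist (f x) (f y) + C)"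
  shows "quasi_isometric_embedding_on S L C f"
  unfolding quasi_isometric_embedding_on_def
proof (intro conjI ballI)
  fix x y assume xy: "x \<in> S" "y \<in> S"
  have "1 / L * dist x y \<le> 1 / L * (L * (dist (f x) (f y) + C))"
    using assms(1) assms(4)[OF xy] by (intro mult_left_mono) auto
  also have "\<dots> = dist (f x) (f y) + C" using assms(1) by simp
  finally show "1 / L * dist x y - C \<le> dist (f x) (f y)" by simp
  show "dist (f x) (f y) \<le> L * dist x y + C" using assms(3)[OF xy] .
qed fact+

text \<open>Each ray is only assumed to be near \<open>h\<close>, so the point is that
  \<open>e\<close> leaves no large gap along \<open>h\<close>. Then every \<open>c t\<close> is near
  some \<open>e n\<close>, and the common origin forces \<open>n\<close> to be close to
  \<open>t\<close>.\<close>

lemma rays_near_quasi_geodesic_bounded_distance: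
  fixes c e h :: "real \<Rightarrow> 'a::metric_space"
  assumes c: "c \<in> boundary x" and e: "e \<in> boundary x"
    and h: "quasi_isometric_embedding_on {0..} L C h" "h 0 = x"
    and cR: "\<And>t. 0 \<le> t \<Longrightarrow> \<exists>s\<ge>0. dist (c t) (h s) \<le> R"
    and eR: "\<And>t. 0 \<le> t \<Longrightarrow> \<exists>s\<ge>0. dist (e t) (h s) \<le> R"
  shows "\<exists>B. \<forall>t\<ge>0. dist (c t) (e t) \<le> B"
proof -
  have L: "1 \<le> L" and C: "0 \<le> C" using h by (auto simp: quasi_isometric_embedding_on_def)
  have R: "0 \<le> R" using cR[of 0] by (meson order.refl order.trans zero_le_dist)
  obtain \<sigma> where \<sigma>: "\<And>t. 0 \<le> t \<Longrightarrow> 0 \<le> \<sigma> t" "\<And>t. 0 \<le> t \<Longrightarrow> dist (e t) (h (\<sigma> t)) \<le> R"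
    using eR by metis
  \<comment> \<open>\<open>A\<close> bounds both \<sigma> at 0 and the jumps of \<sigma> between
    consecutive integers, since the matching points of \<open>h\<close> are at most
    \<open>1 + 2 * R\<close> apart. \<open>B\<close> bounds the path from \<open>c t\<close> to
    \<open>e n\<close> through two points of \<open>h\<close>.\<close>
  define A where "A = L * (1 + 2 * R + C)"
  define B where "B = 2 * R + L * A + C"
  text \<open>The sequence \<open>\<sigma> n\<close> is unbounded and has bounded jumps, so it comes close to every \<open>s\<close>.\<close>
  have close: "\<exists>n::nat. \<bar>s - \<sigma> n\<bar> \<le> A" if s: "0 \<le> s" for s
  proof -
    \<comment> \<open>If all \<sigma> values were at most \<open>s\<close>, the points
      \<open>e n\<close> would stay within \<open>R + L * s + C\<close> of \<open>e 0\<close>,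
      although their distance to it is \<open>n\<close>.\<close>
    have "\<exists>n::nat. s < \<sigma> n"
    proof (rule ccontr)
      assume "\<nexists>n::nat. s < \<sigma> n"
      then have le: "\<sigma> (real n) \<le> s" for n :: nat by (simp add: not_less)
      obtain n :: nat where n: "R + L * s + C < n" using reals_Archimedean2 by blast
      have "real n = dist (e 0) (e n)"
        using boundary_dist[OF e, of 0 n] by simp
      also have "\<dots> \<le> dist (h 0) (h (\<sigma> n)) + dist (e n) (h (\<sigma> n))"
        using boundary_start[OF e] h(2) by (simp add: dist_triangle2)
      also have "\<dots> \<le> L * \<sigma> n + C + R"
        using quasi_isometric_embedding_on_bounds(1)[OF h(1), of 0 "\<sigma> n"] \<sigma>[of n]
        by (simp add: dist_real_def)
      also have "\<dots> \<le> L * s + C + R"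
        using le L by (simp add: mult_left_mono)
      finally show False using n by simp
    qed
    \<comment> \<open>Take the first index at which \<sigma> exceeds \<open>s\<close>. If it is 0,
      both numbers lie in the interval from 0 to \<open>A\<close>; otherwise \<open>s\<close> lies
      within a single jump.\<close>
    then have ex: "s < \<sigma> (real (LEAST n. s < \<sigma> (real n)))"
      by (rule LeastI_ex)
    show ?thesis
    proof (cases "LEAST n. s < \<sigma> (real n)")
      case 0
      have "dist 0 (\<sigma> 0) \<le> L * (dist (h 0) (h (\<sigma> 0)) + C)"
        using quasi_isometric_embedding_on_bounds(2)[OF h(1), of 0 "\<sigma> 0"] \<sigma>(1) by simp
      also have "\<dots> \<le> A"
        unfolding A_def using L R \<sigma>(2)[of 0] boundary_start[OF e] h(2)
        by (intro mult_left_mono) auto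
      finally show ?thesis
        using ex s \<sigma>(1)[of 0] 0 by (intro exI[of _ 0]) (auto simp: dist_real_def)
    next
      case (Suc m)
      have m: "\<not> s < \<sigma> (real m)"
        using Suc by (intro not_less_Least) simp
      have "dist (h (\<sigma> m)) (h (\<sigma> (Suc m))) \<le>
          dist (e m) (h (\<sigma> m)) + dist (e m) (e (Suc m)) + dist (e (Suc m)) (h (\<sigma> (Suc m)))"
        by metric
      also have "\<dots> \<le> 1 + 2 * R"
        using \<sigma>(2)[of m] \<sigma>(2)[of "Suc m"] boundary_dist[OF e, of m "Suc m"] by simp
      finally have "L * (dist (h (\<sigma> m)) (h (\<sigma> (Suc m))) + C) \<le> A"
        unfolding A_def using L by (intro mult_left_mono) auto
      then have "dist (\<sigma> m) (\<sigma> (Suc m)) \<le> A"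
        using quasi_isometric_embedding_on_bounds(2)[OF h(1), of "\<sigma> m" "\<sigma> (Suc m)"]
          \<sigma>(1)[of m] \<sigma>(1)[of "Suc m"] by simp
      then show ?thesis
        using ex m Suc by (intro exI[of _ "Suc m"]) (auto simp: dist_real_def)
    qed
  qed
  have "dist (c t) (e t) \<le> 2 * B" if t: "0 \<le> t" for t
  proof -
    obtain s where s: "0 \<le> s" "dist (c t) (h s) \<le> R" using cR t by blast
    obtain n :: nat where n: "\<bar>s - \<sigma> n\<bar> \<le> A" using close s(1) by blast
    have "dist (h s) (h (\<sigma> n)) \<le> L * dist s (\<sigma> n) + C"
      using quasi_isometric_embedding_on_bounds(1)[OF h(1)] s(1) \<sigma>(1) by simp
    also have "\<dots> \<le> L * A + C"
      using n L by (simp add: dist_real_def mult_left_mono)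
    finally have "dist (h s) (h (\<sigma> n)) \<le> L * A + C" .
    moreover have "dist (c t) (e n) \<le>
        dist (c t) (h s) + dist (h s) (h (\<sigma> n)) + dist (e n) (h (\<sigma> n))"
      by metric
    ultimately have B: "dist (c t) (e n) \<le> B"
      using s(2) \<sigma>(2)[of n] by (simp add: B_def)
    \<comment> \<open>The distance to the common origin recovers the parameter on either
      ray.\<close>
    have "dist x (c t) = t" "dist x (e n) = n"
      using geodesic_between_boundary(2)[OF c t] geodesic_between_boundary(2)[OF e] by auto
    then have "\<bar>t - n\<bar> \<le> B"
      using B dist_triangle[of x "c t" "e n"] dist_triangle[of x "e n" "c t"]
      by (simp add: dist_commute)
    then have "dist (e n) (e t) \<le> B"
      using boundary_dist[OF e, of n t] t by simp
    then show ?thesis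
      using B dist_triangle[of "c t" "e t" "e n"] by simp
  qed
  then show ?thesis by blast
qed

section \<open>The Morse property\<close>

text \<open>As quasi-geodesics may be discontinuous, both endpoints can simply be moved onto
  \<gamma>. This raises the additive constant by \<open>2 * R\<close> and the final bound by
  \<open>R\<close>.\<close>

lemma morse_on_endpoints_near:
  assumes "morse_on I \<gamma>" "1 \<le> L" "0 \<le> C" "0 \<le> R"
  shows "\<exists>M. \<forall>(a::real) b q. a \<le> b \<and> quasi_isometric_embedding_on {a..b} L C q \<and>
           (\<exists>s\<in>I. dist (q a) (\<gamma> s) \<le> R) \<and> (\<exists>s\<in>I. dist (q b) (\<gamma> s) \<le> R) \<longrightarrow>
           (\<forall>t\<in>{a..b}. \<exists>s\<in>I. dist (q t) (\<gamma> s) \<le> M)"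
proof -
  have "0 \<le> C + 2 * R" using assms by simp
  then obtain M where M: "\<And>(a::real) b q. a \<le> b \<Longrightarrow> quasi_isometric_embedding_on {a..b} L (C + 2 * R) q \<Longrightarrow>
      q a \<in> \<gamma> ` I \<Longrightarrow> q b \<in> \<gamma> ` I \<Longrightarrow> \<forall>t\<in>{a..b}. \<exists>s\<in>I. dist (q t) (\<gamma> s) \<le> M"
    using assms(1)[unfolded morse_on_def, rule_format, of L "C + 2 * R"] assms(2) by blast
  have "\<exists>s\<in>I. dist (q t) (\<gamma> s) \<le> M + R"
    if ab: "(a::real) \<le> b" and q: "quasi_isometric_embedding_on {a..b} L C q"
      and u: "u \<in> I" "dist (q a) (\<gamma> u) \<le> R" and v: "v \<in> I" "dist (q b) (\<gamma> v) \<le> R"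
      and t: "t \<in> {a..b}" for a b q u v t
  proof -
    \<comment> \<open>If \<open>a = b\<close> the second update wins; the value is still on \<gamma>
      and within \<open>R\<close> of \<open>q a\<close>.\<close>
    define p where "p = q(a := \<gamma> u, b := \<gamma> v)"
    have pq: "dist (q r) (p r) \<le> R" for r
      using u v \<open>0 \<le> R\<close> by (simp add: p_def)
    have diff: "\<bar>dist (p r) (p s) - dist (q r) (q s)\<bar> \<le> 2 * R" for r s
      using pq[of r] pq[of s] by metric
    have "quasi_isometric_embedding_on {a..b} L (C + 2 * R) p"
    proof (rule quasi_isometric_embedding_onI)
      fix r s assume rs: "r \<in> {a..b}" "s \<in> {a..b}"
      show "dist (p r) (p s) \<le> L * dist r s + (C + 2 * R)"
        using quasi_isometric_embedding_on_bounds(1)[OF q rs] diff[of r s] by simp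
      have "L * (dist (q r) (q s) + C) \<le> L * (dist (p r) (p s) + (C + 2 * R))"
        using diff[of r s] \<open>1 \<le> L\<close> by (intro mult_left_mono) auto
      then show "dist r s \<le> L * (dist (p r) (p s) + (C + 2 * R))"
        using quasi_isometric_embedding_on_bounds(2)[OF q rs] by simp
    qed (use assms in auto)
    moreover have "p a \<in> \<gamma> ` I" "p b \<in> \<gamma> ` I" using u v by (auto simp: p_def)
    ultimately obtain s where "s \<in> I" "dist (p t) (\<gamma> s) \<le> M"
      using M[OF ab] t by blast
    then show ?thesis
      using pq[of t] dist_triangle[of "q t" "\<gamma> s" "p t"] by force
  qed
  then show ?thesis by blast
qed

text \<open>One-sided closeness suffices: comparing distances to the origins shows that
  \<open>s\<close> and \<open>t\<close> differ by at most \<open>M + dist x y\<close>, so the rays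
  are close at equal times.\<close>

lemma boundary_near_imp_asymptotic:
  assumes c: "c \<in> boundary x" and e: "e \<in> boundary y"
    and near: "\<And>t. 0 \<le> t \<Longrightarrow> \<exists>s\<ge>0. dist (c t) (e s) \<le> M"
  shows "asymptotic c e"
proof -
  have "dist (c t) (e t) \<le> 2 * M + dist x y" if t: "0 \<le> t" for t
  proof -
    obtain s where s: "0 \<le> s" "dist (c t) (e s) \<le> M" using near t by blast
    have "dist x (c t) = t" "dist y (e s) = s"
      using geodesic_between_boundary(2)[OF c t] geodesic_between_boundary(2)[OF e s(1)] by auto
    then have "\<bar>s - t\<bar> \<le> M + dist x y"
      using s(2) by metric
    then have "dist (e s) (e t) \<le> M + dist x y"
      using boundary_dist[OF e s(1) t] by simp
    then show ?thesis
      using s(2) dist_triangle[of "c t" "e t" "e s"] by simp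
  qed
  then show ?thesis unfolding asymptotic_def by blast
qed

section \<open>Quasi-inverses\<close>

text \<open>Passing from \<open>y\<close> and \<open>z\<close> to their images under
  \<open>f \<circ> g\<close> changes the distance by at most \<open>2 * K\<close>, so the bounds for
  \<open>f\<close> can be read backwards.\<close>

lemma quasi_inverse_quasi_isometric_embedding:
  fixes f :: "'a::metric_space \<Rightarrow> 'b::metric_space"
  assumes f: "quasi_isometric_embedding_on UNIV L C f" and fg: "\<And>y. dist (f (g y)) y \<le> K"
  shows "quasi_isometric_embedding_on UNIV L (L * (2 * K + C)) g"
proof -
  have L: "1 \<le> L" and C: "0 \<le> C" using f by (auto simp: quasi_isometric_embedding_on_def)
  have K: "0 \<le> K" using fg zero_le_dist order.trans by blast
  have diff: "\<bar>dist (f (g y)) (f (g z)) - dist y z\<bar> \<le> 2 * K" for y z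
    using fg[of y] fg[of z] by metric
  \<comment> \<open>The upper bound for \<open>g\<close> dictates the additive constant; since
    \<open>L\<close> is at least 1, it also covers the \<open>2 * K + C\<close> arising in the lower
    bound.\<close>
  have KC: "2 * K + C \<le> L * (2 * K + C)" using L K C by (simp add: mult_le_cancel_right1)
  show ?thesis
  proof (rule quasi_isometric_embedding_onI)
    fix y z
    have "dist (g y) (g z) \<le> L * (dist (f (g y)) (f (g z)) + C)"
      using quasi_isometric_embedding_on_bounds(2)[OF f] by simp
    also have "\<dots> \<le> L * (dist y z + 2 * K + C)"
      using L diff[of y z] by (intro mult_left_mono) auto
    finally show "dist (g y) (g z) \<le> L * dist y z + L * (2 * K + C)"
      by (simp add: algebra_simps)
    have "dist y z \<le> L * dist (g y) (g z) + (2 * K + C)"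
      using quasi_isometric_embedding_on_bounds(1)[OF f, of "g y" "g z"] diff[of y z] by simp
    also have "\<dots> \<le> L * dist (g y) (g z) + L * (L * (2 * K + C))"
      using KC L K C by (intro add_left_mono) (smt (verit) mult_left_mono mult_nonneg_nonneg mult_le_cancel_right1)
    finally show "dist y z \<le> L * (dist (g y) (g z) + L * (2 * K + C))"
      by (simp add: algebra_simps)
  qed (use L K C in auto)
qed

section \<open>Boundary maps and Morse paths\<close>

lemma quasi_isometric_embedding_ray_diverges:
  assumes f: "quasi_isometric_embedding_on UNIV L C f" and \<alpha>: "\<alpha> \<in> boundary x"
    and d: "scaling_sequence \<omega> d"
  shows "filterlim (\<lambda>n. dist (f (\<alpha> 0)) (f (\<alpha> (d n)))) at_top \<omega>"
  unfolding filterlim_at_top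
proof
  fix Z
  have L: "1 \<le> L" using f by (auto simp: quasi_isometric_embedding_on_def)
  have "eventually (\<lambda>n. L * (Z + C) \<le> d n) \<omega>"
    using d unfolding scaling_sequence_def filterlim_at_top by blast
  then show "eventually (\<lambda>n. Z \<le> dist (f (\<alpha> 0)) (f (\<alpha> (d n)))) \<omega>"
  proof eventually_elim
    case (elim n)
    have "0 < d n" using d by (simp add: scaling_sequence_def)
    then have "dist (\<alpha> 0) (\<alpha> (d n)) = d n"
      using boundary_dist[OF \<alpha>, of 0 "d n"] by simp
    then have "L * (Z + C) \<le> L * (dist (f (\<alpha> 0)) (f (\<alpha> (d n))) + C)"
      using quasi_isometric_embedding_on_bounds(2)[OF f, of "\<alpha> 0" "\<alpha> (d n)"] elim by simp
    then show ?case using L by simp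
  qed
qed

lemma quasi_isometric_embedding_on_comp_isometry:
  assumes f: "quasi_isometric_embedding_on UNIV L C f"
    and c: "\<And>s t. s \<in> S \<Longrightarrow> t \<in> S \<Longrightarrow> dist (c s) (c t) = dist s t"
  shows "quasi_isometric_embedding_on S L C (\<lambda>t. f (c t))"
  unfolding quasi_isometric_embedding_on_def
proof (intro conjI ballI)
  fix s t assume "s \<in> S" "t \<in> S"
  then have "dist s t = dist (c s) (c t)" by (simp add: c)
  then show "1 / L * dist s t - C \<le> dist (f (c s)) (f (c t))"
    and "dist (f (c s)) (f (c t)) \<le> L * dist s t + C"
    using f by (simp_all add: quasi_isometric_embedding_on_def)
qed (use f in \<open>simp_all add: quasi_isometric_embedding_on_def\<close>)

text \<open>Images under \<open>g\<close> of the approximating segments are quasi-geodesics with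
  uniform constants and endpoints near \<gamma>, so one bound serves all \<open>n\<close>, all times
  and all scaling sequences. Keeping \<open>g\<close> and \<gamma> general allows two uses: with a
  quasi-inverse, and with the identity.\<close>

lemma boundary_map_morse_near:
  fixes f :: "'a::metric_space \<Rightarrow> 'b::{cat0_space, heine_borel}" and g :: "'b \<Rightarrow> 'c::metric_space"
    and \<gamma> :: "real \<Rightarrow> 'c"
  assumes \<omega>: "nonprincipal_ultrafilter \<omega>"
    and f: "quasi_isometric_embedding_on UNIV L C f" and \<alpha>: "\<alpha> \<in> boundary x"
    and g: "quasi_isometric_embedding_on UNIV L' C' g" and morse: "morse_on I \<gamma>"
    and gf: "\<And>t. 0 \<le> t \<Longrightarrow> \<exists>s\<in>I. dist (g (f (\<alpha> t))) (\<gamma> s) \<le> K"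
  shows "\<exists>M. \<forall>d. scaling_sequence \<omega> d \<longrightarrow>
           (\<forall>t\<ge>0. \<exists>s\<in>I. dist (g (boundary_map \<omega> f d \<alpha> t)) (\<gamma> s) \<le> M)"
proof -
  have L': "1 \<le> L'" "0 \<le> C'" using g by (auto simp: quasi_isometric_embedding_on_def)
  have K: "0 \<le> K" using gf[of 0] by (meson order.refl order.trans zero_le_dist)
  obtain M where M: "\<And>(a::real) b q. a \<le> b \<Longrightarrow> quasi_isometric_embedding_on {a..b} L' C' q \<Longrightarrow>
      \<exists>s\<in>I. dist (q a) (\<gamma> s) \<le> K \<Longrightarrow> \<exists>s\<in>I. dist (q b) (\<gamma> s) \<le> K \<Longrightarrow>
      \<forall>t\<in>{a..b}. \<exists>s\<in>I. dist (q t) (\<gamma> s) \<le> M"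
    using morse_on_endpoints_near[OF morse L' K] by meson
  have "\<exists>s\<in>I. dist (g (boundary_map \<omega> f d \<alpha> t)) (\<gamma> s) \<le> L' + C' + M"
    if d: "scaling_sequence \<omega> d" and t: "0 \<le> t" for d t
  proof -
    let ?D = "\<lambda>n. dist (f (\<alpha> 0)) (f (\<alpha> (d n)))"
    let ?c = "\<lambda>n. geodesic_segment (f (\<alpha> 0)) (f (\<alpha> (d n)))"
    note lim = quasi_isometric_embedding_ray_diverges[OF f \<alpha> d]
    \<comment> \<open>\<open>g\<close> may be discontinuous, so no limit is taken after applying it:
      a single segment within 1 of the limit point costs only \<open>L' + C'\<close>.\<close>
    have "eventually (\<lambda>n. dist (?c n t) (boundary_map \<omega> f d \<alpha> t) < 1) \<omega>"
      using boundary_map_tendsto[where f = f and \<alpha> = \<alpha> and d = d, OF \<omega> lim t] by (rule tendstoD) simp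
    moreover have "eventually (\<lambda>n. t \<le> ?D n) \<omega>"
      using lim by (simp add: filterlim_at_top)
    ultimately have "eventually (\<lambda>n. dist (?c n t) (boundary_map \<omega> f d \<alpha> t) < 1 \<and> t \<le> ?D n) \<omega>"
      by (rule eventually_conj)
    moreover have "\<omega> \<noteq> bot" using \<omega> by (simp add: nonprincipal_ultrafilter_def)
    ultimately obtain n where n: "dist (?c n t) (boundary_map \<omega> f d \<alpha> t) < 1" "t \<le> ?D n"
      using eventually_happens by blast
    have "quasi_isometric_embedding_on {0..?D n} L' C' (\<lambda>t. g (?c n t))"
      using g by (rule quasi_isometric_embedding_on_comp_isometry)
        (simp add: dist_geodesic_segment dist_real_def)
    moreover have "0 < d n" using d by (simp add: scaling_sequence_def)
    ultimately obtain s where s: "s \<in> I" "dist (g (?c n t)) (\<gamma> s) \<le> M"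
      using M[of 0 "?D n" "\<lambda>t. g (?c n t)"] gf[of 0] gf[of "d n"] t n(2)
      by (force intro: less_imp_le)
    have "dist (g (?c n t)) (g (boundary_map \<omega> f d \<alpha> t)) \<le>
        L' * dist (?c n t) (boundary_map \<omega> f d \<alpha> t) + C'"
      using quasi_isometric_embedding_on_bounds(1)[OF g] by simp
    also have "\<dots> \<le> L' + C'"
      using n(1) L' by (simp add: mult_left_le)
    finally show ?thesis
      using s dist_triangle3[of "g (boundary_map \<omega> f d \<alpha> t)" "\<gamma> s" "g (?c n t)"] by force
  qed
  then show ?thesis by blast
qed

theorem lemma6p15:
  fixes f :: "'a::{cat0_space, heine_borel} \<Rightarrow> 'b::{cat0_space, heine_borel}"
    and g :: "'b \<Rightarrow> 'a"
    and \<omega> :: "nat filter"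
    and x0 :: 'a
    and \<alpha> :: "real \<Rightarrow> 'a"
  assumes "quasi_isometry f"
    and "quasi_inverse f g"
    and "nonprincipal_ultrafilter \<omega>"
    and "\<alpha> \<in> boundary x0"
    and "morse_on {0..} \<alpha>"
  shows "\<forall>d d'. scaling_sequence \<omega> d \<and> scaling_sequence \<omega> d' \<longrightarrow>
           boundary_map \<omega> f d \<alpha> = boundary_map \<omega> f d' \<alpha> \<and>
           asymptotic (boundary_map \<omega> g d' (boundary_map \<omega> f d \<alpha>)) \<alpha>"
proof -
  note \<omega> = assms(3) and \<alpha> = assms(4) and morse = assms(5)
  obtain L C where f: "quasi_isometric_embedding_on UNIV L C f"
    using assms(1) by (auto simp: quasi_isometry_def)
  obtain K where gf: "\<And>x. dist (g (f x)) x \<le> K" and fg: "\<And>y. dist (f (g y)) y \<le> K"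
    using assms(2) by (auto simp: quasi_inverse_def)
  define C' where "C' = L * (2 * K + C)"
  have g: "quasi_isometric_embedding_on UNIV L C' g"
    unfolding C'_def using f fg by (rule quasi_inverse_quasi_isometric_embedding)
  have L: "1 \<le> L" using f by (auto simp: quasi_isometric_embedding_on_def)
  obtain M where M: "\<And>d t. scaling_sequence \<omega> d \<Longrightarrow> 0 \<le> t \<Longrightarrow>
      \<exists>s\<ge>0. dist (g (boundary_map \<omega> f d \<alpha> t)) (\<alpha> s) \<le> M"
  proof -
    have "\<exists>s\<in>{0..}. dist (g (f (\<alpha> t))) (\<alpha> s) \<le> K" if "0 \<le> t" for t
      using gf that by auto
    then show ?thesis
      using boundary_map_morse_near[OF \<omega> f \<alpha> g morse] by (metis atLeast_iff that)
  qed
  have ray: "boundary_map \<omega> f d \<alpha> \<in> boundary (f x0)" if "scaling_sequence \<omega> d" for d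
    using boundary_map_in_boundary[where f = f and \<alpha> = \<alpha>, OF \<omega>]
      quasi_isometric_embedding_ray_diverges[OF f \<alpha> that] boundary_start[OF \<alpha>] by simp
  \<comment> \<open>Closeness after \<open>g\<close> is carried back by \<open>f\<close>:
    \<open>K\<close> is the cost of replacing a point by its image under \<open>f \<circ> g\<close>,
    and \<open>L * M + C\<close> is what \<open>f\<close> makes of the bound
    \<open>M\<close>.\<close>
  have near: "\<exists>s\<ge>0. dist (boundary_map \<omega> f d \<alpha> t) (f (\<alpha> s)) \<le> K + (L * M + C)"
    if d: "scaling_sequence \<omega> d" and t: "0 \<le> t" for d t
  proof -
    let ?y = "boundary_map \<omega> f d \<alpha> t"
    obtain s where s: "0 \<le> s" "dist (g ?y) (\<alpha> s) \<le> M" using M[OF d t] by blast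
    have "dist (f (g ?y)) (f (\<alpha> s)) \<le> L * dist (g ?y) (\<alpha> s) + C"
      using quasi_isometric_embedding_on_bounds(1)[OF f] by simp
    also have "\<dots> \<le> L * M + C" using s L by (simp add: mult_left_mono)
    finally show ?thesis
      using s(1) fg[of ?y] dist_triangle3[of ?y "f (\<alpha> s)" "f (g ?y)"] by force
  qed
  have "boundary_map \<omega> f d \<alpha> = boundary_map \<omega> f d' \<alpha>"
    if d: "scaling_sequence \<omega> d" and d': "scaling_sequence \<omega> d'" for d d'
  proof -
    have "quasi_isometric_embedding_on {0..} L C (\<lambda>t. f (\<alpha> t))"
      using f by (rule quasi_isometric_embedding_on_comp_isometry)
        (simp add: boundary_dist[OF \<alpha>] dist_real_def)
    then obtain B where "\<forall>t\<ge>0. dist (boundary_map \<omega> f d \<alpha> t) (boundary_map \<omega> f d' \<alpha> t) \<le> B"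
      using rays_near_quasi_geodesic_bounded_distance[OF ray[OF d] ray[OF d']]
        near[OF d] near[OF d'] boundary_start[OF \<alpha>] by blast
    then show ?thesis
      using rays_at_bounded_distance_eq[OF ray[OF d] ray[OF d']] by blast
  qed
  moreover have "asymptotic (boundary_map \<omega> g d' (boundary_map \<omega> f d \<alpha>)) \<alpha>"
    if d: "scaling_sequence \<omega> d" and d': "scaling_sequence \<omega> d'" for d d'
  proof -
    define \<beta> where "\<beta> = boundary_map \<omega> f d \<alpha>"
    have \<beta>: "\<beta> \<in> boundary (f x0)" unfolding \<beta>_def using d by (rule ray)
    \<comment> \<open>This ray starts at \<open>g (f x0)\<close>, which may differ from
      \<open>x0\<close>, hence asymptoty instead of equality.\<close>
    have ray': "boundary_map \<omega> g d' \<beta> \<in> boundary (g (\<beta> 0))"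
      using boundary_map_in_boundary[where f = g and \<alpha> = \<beta>, OF \<omega>]
        quasi_isometric_embedding_ray_diverges[OF g \<beta> d'] by blast
    \<comment> \<open>In the second use of the Morse argument, \<open>g\<close> is the map inducing
      the boundary map and the identity takes the place of the quasi-inverse; the earlier
      \<open>M\<close> is now the endpoint error.\<close>
    have "quasi_isometric_embedding_on UNIV 1 0 (\<lambda>x::'a. x)"
      by (simp add: quasi_isometric_embedding_on_def)
    moreover have "\<exists>s\<in>{0..}. dist (g (\<beta> t)) (\<alpha> s) \<le> M" if "0 \<le> t" for t
      using M[OF d that] by (auto simp: \<beta>_def)
    ultimately obtain N where "\<forall>t\<ge>0. \<exists>s\<in>{0..}. dist (boundary_map \<omega> g d' \<beta> t) (\<alpha> s) \<le> N"
      using boundary_map_morse_near[OF \<omega> g \<beta> _ morse, of 1 0 "\<lambda>x. x" M] d' by blast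
    then show ?thesis
      unfolding \<beta>_def[symmetric] using boundary_near_imp_asymptotic[OF ray' \<alpha>] by (meson atLeast_iff)
  qed
  ultimately show ?thesis by blast
qed

end
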